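(* Let $n\ge1$ and $\theta>0$. The twisted Burnside process with parameter $\theta$ on $C_2^n=\{0,1\}^n$, lumped to the orbits of $S_n$ (i.e. recording only the number of ones), is a Markov chain on $\{0,1,\dots,n\}$ whose stationary distribution is the beta-binomial distribution with parameters $\alpha=\beta=\theta$, namely $$m(j)=\binom nj\frac{(\theta)_j(\theta)_{n-j}}{(2\theta)_n},\qquad 0\le j\le n.$$
   Context: Notation: $(a)_m=a(a+1)\cdots(a+m-1)$, $(a)_0=1$. The Ewens distribution with parameter $\theta$ on the symmetric group $S_m$ is $\mathbb{P}_\theta(\sigma)=\frac{\theta^{c(\sigma)}}{(\theta)_m}$, where $c(\sigma)$ is the number of cycles of $\sigma$ (fixed points included). The beta-binomial distribution with parameters $\alpha,\beta>0$ is $m(j)=\binom nj\frac{(\alpha)_j(\beta)_{n-j}}{(\alpha+\beta)_n}$ on $\{0,\dots,n\}$. The twisted Burnside process with parameter $\theta$ on $\{0,1\}^n$ moves as follows. From $x$ with $|x|$ ones, identify the subgroup $G_x\subseteq S_n$ of permutations of coordinates fixing $x$ with $S_{|x|}\times S_{n-|x|}$ (permuting the positions of the ones among themselves and the positions of the zeros among themselves). Pick $\sigma\in S_{|x|}\times S_{n-|x|}$ by choosing its two components independently from the Ewens distributions with parameter $\theta$. Break $\sigma$ (as a permutation of the $n$ coordinates) into cycles and label each cycle independently $0$ or $1$ with probability $\frac12$ each. The new state $y\in\{0,1\}^n$ has each coordinate equal to the label of the cycle containing it. *)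

theory Defs
  imports "HOL-Probability.Probability" "HOL-Combinatorics.Orbits"
begin

section \<open>The Ewens distribution\<close>

definition cycles_of :: "('a \<Rightarrow> 'a) \<Rightarrow> 'a set \<Rightarrow> 'a set set" where
  "cycles_of \<sigma> A = orbit \<sigma> ` A"

definition num_cycles :: "('a \<Rightarrow> 'a) \<Rightarrow> 'a set \<Rightarrow> nat" where
  "num_cycles \<sigma> A = card (cycles_of \<sigma> A)"

text \<open>The Ewens distribution on the symmetric group of a finite set \<open>A\<close>. The lemma \<open>pmf_ewens\<close>
  below shows that for \<open>\<theta> > 0\<close> these weights do sum to 1, so that \<^const>\<open>embed_pmf\<close> is meaningful.\<close>

definition ewens_pmf :: "real \<Rightarrow> 'a set \<Rightarrow> ('a \<Rightarrow> 'a) pmf" where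
  "ewens_pmf \<theta> A =
     embed_pmf (\<lambda>\<sigma>. if \<sigma> permutes A then \<theta> ^ num_cycles \<sigma> A / pochhammer \<theta> (card A) else 0)"

lemma num_cycles_insert_fixed:
  assumes "finite A" "a \<notin> A" "q permutes A"
  shows "num_cycles q (insert a A) = Suc (num_cycles q A)"
proof -
  have "q a = a" using assms by (simp add: permutes_def)
  hence 1: "orbit q a = {a}" by (simp add: orbit_eq_singleton_iff)
  have "a \<notin> orbit q x" if "x \<in> A" for x
    using permutes_orbit_subset[OF assms(3) that] assms(2) by auto
  hence "{a} \<notin> orbit q ` A" by auto
  thus ?thesis using assms(1) 1 by (simp add: num_cycles_def cycles_of_def)
qed

lemma num_cycles_insert_moved:
  assumes fin: "finite A" and a: "a \<notin> A" and q: "q permutes A" and b: "b \<in> A"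
  shows "num_cycles (Transposition.transpose a b \<circ> q) (insert a A) = num_cycles q A"
proof -
  define p where "p = Transposition.transpose a b \<circ> q"
  define h where "h C = (if b \<in> C then insert a C else C)" for C
  have ab: "a \<noteq> b" using a b by auto
  have qa: "q a = a" using a q by (simp add: permutes_def)
  have pa: "p a = b" using qa by (simp add: p_def)
  have qA: "q y \<in> A \<longleftrightarrow> y \<in> A" for y using q by (rule permutes_in_image)
  have p1: "p y = q y" if "y \<in> A" "q y \<noteq> b" for y
    using that qA[of y] a by (auto simp: p_def Transposition.transpose_def)
  have p2: "p y = a" if "q y = b" for y
    using that ab by (auto simp: p_def Transposition.transpose_def)
  have orb: "orbit p x = h (orbit q x)" if x: "x \<in> A" for x
  proof
    have sub: "orbit q x \<subseteq> A" using q x by (rule permutes_orbit_subset)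
    have xq: "x \<in> orbit q x"
      using fin q by (intro permutation_self_in_orbit) (auto simp: permutation_permutes)
    show "orbit p x \<subseteq> h (orbit q x)"
    proof
      have step: "p z \<in> h (orbit q x)" if z: "z \<in> h (orbit q x)" for z
      proof (cases "z = a")
        case True
        hence "b \<in> orbit q x" using z sub a by (auto simp: h_def split: if_splits)
        thus ?thesis using True pa by (simp add: h_def)
      next
        case False
        hence zo: "z \<in> orbit q x" using z by (auto simp: h_def split: if_splits)
        hence "q z \<in> orbit q x" by (rule orbit.step)
        thus ?thesis using zo sub p1[of z] p2[of z] by (cases "q z = b") (auto simp: h_def)
      qed
      fix y assume "y \<in> orbit p x"
      thus "y \<in> h (orbit q x)"
      proof induction
        case base
        show ?case by (rule step) (use xq in \<open>simp add: h_def\<close>)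
      next
        case (step y)
        show ?case by (rule \<open>\<And>z. z \<in> h (orbit q x) \<Longrightarrow> p z \<in> h (orbit q x)\<close>) fact
      qed
    qed
    have reach: "y \<in> orbit p x \<and> (y = b \<longrightarrow> a \<in> orbit p x)" if "y \<in> orbit q x" for y
      using that
    proof induction
      case base
      show ?case
      proof (cases "q x = b")
        case True
        hence "a \<in> orbit p x" using p2[of x] orbit.base[of p x] by simp
        thus ?thesis using True pa orbit.step[of a p x] by auto
      next
        case False
        thus ?thesis using p1[OF x] orbit.base[of p x] by auto
      qed
    next
      case (step y)
      have yA: "y \<in> A" using step sub by auto
      show ?case
      proof (cases "q y = b")
        case True
        hence "a \<in> orbit p x" using p2[of y] orbit.step[of y p x] step by auto
        thus ?thesis using True pa orbit.step[of a p x] by auto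
      next
        case False
        thus ?thesis using p1[OF yA] orbit.step[of y p x] step by auto
      qed
    qed
    show "h (orbit q x) \<subseteq> orbit p x" using reach by (auto simp: h_def)
  qed
  have "p permutes insert a A" unfolding p_def
    by (intro permutes_compose permutes_swap_id permutes_subset[OF q]) (use b in auto)
  hence "permutation p" using fin by (auto simp: permutation_permutes)
  hence "orbit p a = orbit p b" using permutation_orbit_step[of p a] pa by simp
  hence "orbit p ` insert a A = h ` (orbit q ` A)"
    using b orb by (auto simp: image_image)
  moreover have "inj_on h (orbit q ` A)"
  proof (rule inj_onI)
    fix C D assume "C \<in> orbit q ` A" "D \<in> orbit q ` A" and eq: "h C = h D"
    hence "a \<notin> C" "a \<notin> D" using a permutes_orbit_subset[OF q] by blast+
    thus "C = D" using eq by (auto simp: h_def split: if_splits)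
  qed
  ultimately show ?thesis
    by (simp add: num_cycles_def cycles_of_def card_image flip: p_def)
qed

lemma sum_ewens_weights:
  fixes \<theta> :: real
  assumes "finite A"
  shows "(\<Sum>\<sigma> | \<sigma> permutes A. \<theta> ^ num_cycles \<sigma> A) = pochhammer \<theta> (card A)"
  using assms
proof (induction A)
  case empty
  show ?case by (simp add: num_cycles_def cycles_of_def)
next
  case (insert a A)
  have "(\<Sum>\<sigma> | \<sigma> permutes insert a A. \<theta> ^ num_cycles \<sigma> (insert a A)) =
      (\<Sum>q | q permutes A. \<theta> ^ num_cycles (Transposition.transpose a a \<circ> q) (insert a A)) +
      (\<Sum>b\<in>A. \<Sum>q | q permutes A. \<theta> ^ num_cycles (Transposition.transpose a b \<circ> q) (insert a A))"
    unfolding sum_over_permutations_insert[OF insert.hyps] using insert.hyps by simp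
  also have "\<dots> = \<theta> * pochhammer \<theta> (card A) + of_nat (card A) * pochhammer \<theta> (card A)"
    using insert.hyps
    by (simp add: num_cycles_insert_fixed num_cycles_insert_moved insert.IH
        flip: sum_distrib_left)
  also have "\<dots> = pochhammer \<theta> (card (insert a A))"
    using insert.hyps by (simp add: pochhammer_Suc algebra_simps)
  finally show ?case .
qed

lemma pmf_ewens:
  assumes "\<theta> > 0" "finite A"
  shows "pmf (ewens_pmf \<theta> A) \<sigma> =
    (if \<sigma> permutes A then \<theta> ^ num_cycles \<sigma> A / pochhammer \<theta> (card A) else 0)"
  unfolding ewens_pmf_def
proof (rule pmf_embed_pmf)
  let ?f = "\<lambda>\<sigma>. if \<sigma> permutes A then \<theta> ^ num_cycles \<sigma> A / pochhammer \<theta> (card A) else 0"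
  have pos: "pochhammer \<theta> (card A) > 0" using assms(1) by (rule pochhammer_pos)
  show nonneg: "0 \<le> ?f \<sigma>" for \<sigma> using assms(1) pos by simp
  have "(\<integral>\<^sup>+\<sigma>. ennreal (?f \<sigma>) \<partial>count_space UNIV) =
      (\<Sum>\<sigma> | \<sigma> permutes A. ennreal (?f \<sigma>))"
    by (rule nn_integral_count_space'[OF finite_permutations[OF assms(2)]])
      auto
  also have "\<dots> = ennreal (\<Sum>\<sigma> | \<sigma> permutes A. ?f \<sigma>)"
    by (rule sum_ennreal) (rule nonneg)
  also have "(\<Sum>\<sigma> | \<sigma> permutes A. ?f \<sigma>) = 1"
    using sum_ewens_weights[OF assms(2), of \<theta>] pos by (simp flip: sum_divide_distrib)
  finally show "(\<integral>\<^sup>+\<sigma>. ennreal (?f \<sigma>) \<partial>count_space UNIV) = 1" by simp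
qed


section \<open>The beta-binomial distribution\<close>

definition beta_binomial_pmf :: "nat \<Rightarrow> real \<Rightarrow> real \<Rightarrow> nat pmf" where
  "beta_binomial_pmf n \<alpha> \<beta> =
     embed_pmf (\<lambda>j. if j \<le> n
       then real (n choose j) * (pochhammer \<alpha> j * pochhammer \<beta> (n - j)) / pochhammer (\<alpha> + \<beta>) n
       else 0)"

lemma pmf_beta_binomial:
  assumes "\<alpha> > 0" "\<beta> > 0"
  shows "pmf (beta_binomial_pmf n \<alpha> \<beta>) j =
    (if j \<le> n
     then real (n choose j) * (pochhammer \<alpha> j * pochhammer \<beta> (n - j)) / pochhammer (\<alpha> + \<beta>) n
     else 0)"
  unfolding beta_binomial_pmf_def
proof (rule pmf_embed_pmf)
  let ?f = "\<lambda>j. if j \<le> n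
     then real (n choose j) * (pochhammer \<alpha> j * pochhammer \<beta> (n - j)) / pochhammer (\<alpha> + \<beta>) n
     else 0"
  have pos: "pochhammer (\<alpha> + \<beta>) n > 0" using assms by (intro pochhammer_pos) simp
  show nonneg: "0 \<le> ?f j" for j
    using assms pos by (simp add: pochhammer_nonneg)
  have "(\<integral>\<^sup>+j. ennreal (?f j) \<partial>count_space UNIV) = (\<Sum>j\<le>n. ennreal (?f j))"
    by (rule nn_integral_count_space') auto
  also have "\<dots> = ennreal (\<Sum>j\<le>n. ?f j)" by (rule sum_ennreal) (rule nonneg)
  also have "(\<Sum>j\<le>n. ?f j) = 1"
    using pos pochhammer_binomial_sum[of \<alpha> \<beta> n]
    by (simp add: mult.assoc flip: sum_divide_distrib)
  finally show "(\<integral>\<^sup>+j. ennreal (?f j) \<partial>count_space UNIV) = 1" by simp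
qed


section \<open>Markov chains, lumping, stationarity\<close>

text \<open>\<open>trajectory K \<mu> t\<close> is the law of \<open>[X\<^sub>0, \<dots>, X\<^sub>t]\<close> for the Markov chain with
  transition kernel \<open>K\<close> and initial law \<open>\<mu>\<close>.\<close>

primrec trajectory_from :: "('a \<Rightarrow> 'a pmf) \<Rightarrow> 'a \<Rightarrow> nat \<Rightarrow> 'a list pmf" where
  "trajectory_from K x 0 = return_pmf [x]"
| "trajectory_from K x (Suc t) =
     do {y \<leftarrow> K x; ys \<leftarrow> trajectory_from K y t; return_pmf (x # ys)}"

definition trajectory :: "('a \<Rightarrow> 'a pmf) \<Rightarrow> 'a pmf \<Rightarrow> nat \<Rightarrow> 'a list pmf" where
  "trajectory K \<mu> t = do {x \<leftarrow> \<mu>; trajectory_from K x t}"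

definition markov_kernel_on :: "'a set \<Rightarrow> ('a \<Rightarrow> 'a pmf) \<Rightarrow> bool" where
  "markov_kernel_on S K \<longleftrightarrow> (\<forall>x\<in>S. set_pmf (K x) \<subseteq> S)"

text \<open>The process \<open>f X\<^sub>0, f X\<^sub>1, \<dots>\<close> is a Markov chain on \<open>T\<close> with transition kernel \<open>Q\<close>, whatever
  the initial law of the chain \<open>X\<close> on \<open>S\<close> with transition kernel \<open>K\<close>.\<close>

definition lumps_to ::
  "'a set \<Rightarrow> ('a \<Rightarrow> 'a pmf) \<Rightarrow> ('a \<Rightarrow> 'b) \<Rightarrow> 'b set \<Rightarrow> ('b \<Rightarrow> 'b pmf) \<Rightarrow> bool" where
  "lumps_to S K f T Q \<longleftrightarrow>
     markov_kernel_on S K \<and> f ` S = T \<and> markov_kernel_on T Q \<and>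
     (\<forall>\<mu>. set_pmf \<mu> \<subseteq> S \<longrightarrow>
        (\<forall>t. map_pmf (map f) (trajectory K \<mu> t) = trajectory Q (map_pmf f \<mu>) t))"

definition stationary_on :: "'a set \<Rightarrow> ('a \<Rightarrow> 'a pmf) \<Rightarrow> 'a pmf \<Rightarrow> bool" where
  "stationary_on S K \<mu> \<longleftrightarrow> set_pmf \<mu> \<subseteq> S \<and> bind_pmf \<mu> K = \<mu>"


section \<open>The twisted Burnside process\<close>

definition cube :: "nat \<Rightarrow> (nat \<Rightarrow> bool) set" where
  "cube n = {..<n} \<rightarrow>\<^sub>E UNIV"

definition ones :: "nat \<Rightarrow> (nat \<Rightarrow> bool) \<Rightarrow> nat set" where
  "ones n x = {i. i < n \<and> x i}"

definition zeros :: "nat \<Rightarrow> (nat \<Rightarrow> bool) \<Rightarrow> nat set" where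
  "zeros n x = {i. i < n \<and> \<not> x i}"

definition num_ones :: "nat \<Rightarrow> (nat \<Rightarrow> bool) \<Rightarrow> nat" where
  "num_ones n x = card (ones n x)"

text \<open>A permutation of \<open>{..<n}\<close> fixing \<open>x\<close> is a product of a permutation of the positions of the
  ones and a permutation of the positions of the zeros. The third argument of \<^const>\<open>Pi_pmf\<close> is only
  the default value outside the set of cycles.\<close>

definition twisted_burnside :: "nat \<Rightarrow> real \<Rightarrow> (nat \<Rightarrow> bool) \<Rightarrow> (nat \<Rightarrow> bool) pmf" where
  "twisted_burnside n \<theta> x = do {
     \<sigma>\<^sub>1 \<leftarrow> ewens_pmf \<theta> (ones n x);
     \<sigma>\<^sub>0 \<leftarrow> ewens_pmf \<theta> (zeros n x);
     let \<sigma> = \<sigma>\<^sub>1 \<circ> \<sigma>\<^sub>0;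
     label \<leftarrow> Pi_pmf (cycles_of \<sigma> {..<n}) False (\<lambda>_. bernoulli_pmf (1/2));
     return_pmf (\<lambda>i\<in>{..<n}. label (orbit \<sigma> i))
   }"

end

theory Submission
  imports Defs
begin

text \<open>Why the theorem is true. Write \<open>G\<^sub>x\<close> for the stabilizer of \<open>x\<close> in the symmetric group,
  \<open>c(\<sigma>)\<close> for the number of cycles, and \<open>w(x) = (\<theta>)\<^sub>j (\<theta>)\<^bsub>n-j\<^esub>\<close> with \<open>j\<close> the number of
  ones of \<open>x\<close>. Since \<open>G\<^sub>x\<close> is the product of the symmetric groups on the ones and on the zeros,
  and cycles add up in such a product, a pair of independent Ewens permutations is an element of
  \<open>G\<^sub>x\<close> drawn with probability \<open>\<theta>\<^bsup>c(\<sigma>)\<^esup> / w(x)\<close>. Given \<open>\<sigma>\<close>, the coin flips produce each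
  \<open>y\<close> that is constant on the cycles of \<open>\<sigma>\<close>, that is with \<open>\<sigma> \<in> G\<^sub>y\<close>, with probability
  \<open>(1/2)\<^bsup>c(\<sigma>)\<^esup>\<close>. Summing over \<open>\<sigma>\<close> (\<open>pmf_twisted_burnside\<close>),

  \<open>K(x, y) w(x) = \<Sum>\<sigma> \<in> G\<^sub>x \<inter> G\<^sub>y. (\<theta>/2)\<^bsup>c(\<sigma>)\<^esup>\<close>.

  Everything is read off from the right-hand side. It is symmetric in \<open>x\<close> and \<open>y\<close>, so the chain
  on the cube is reversible with respect to \<open>w\<close> (\<open>stationary_on_layered\<close>); there are \<open>n choose j\<close>
  states with \<open>j\<close> ones, so the number of ones is beta-binomial under the normalised \<open>w\<close>. It does
  not change when both \<open>x\<close> and \<open>y\<close> are composed with a permutation \<open>\<pi>\<close> of the coordinates, because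
  conjugation by \<open>\<pi>\<close> maps the stabilizers to each other and preserves the number of cycles; as two
  states with equally many ones differ by such a \<open>\<pi>\<close>, the law of the next number of ones depends
  only on the present one, which is the criterion for lumping (\<open>lumps_toI\<close>). Finally, the identity
  lies in every stabilizer, so every transition has positive probability, and a finite chain with
  this property has only one stationary law (\<open>stationary_on_unique\<close>).\<close>

section \<open>Lumping, reversibility and uniqueness for Markov kernels\<close>

text \<open>Dynkin's criterion: if the law of \<open>f\<close> after one step from \<open>x\<close> depends on \<open>x\<close> only through
  \<open>f x\<close>, then, step by step, so does the law of the whole image trajectory.\<close>

lemma lumps_toI:
  assumes kernel: "markov_kernel_on S K"
    and lump: "\<And>x. x \<in> S \<Longrightarrow> map_pmf f (K x) = Q (f x)"
  shows "lumps_to S K f (f ` S) Q"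
proof -
  have from_state: "map_pmf (map f) (trajectory_from K x t) = trajectory_from Q (f x) t"
    if "x \<in> S" for x t
    using that
  proof (induction t arbitrary: x)
    case 0
    then show ?case by simp
  next
    case (Suc t)
    have next_in: "y \<in> S" if "y \<in> set_pmf (K x)" for y
      using that kernel Suc.prems by (auto simp: markov_kernel_on_def)
    have "map_pmf (map f) (trajectory_from K x (Suc t)) =
        bind_pmf (K x) (\<lambda>y. map_pmf ((#) (f x)) (map_pmf (map f) (trajectory_from K y t)))"
      by (simp add: map_bind_pmf map_pmf_comp flip: map_pmf_def)
    also have "\<dots> = bind_pmf (K x) (\<lambda>y. map_pmf ((#) (f x)) (trajectory_from Q (f y) t))"
      using next_in by (intro bind_pmf_cong refl) (simp add: Suc.IH)
    also have "\<dots> = bind_pmf (map_pmf f (K x))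
        (\<lambda>z. map_pmf ((#) (f x)) (trajectory_from Q z t))"
      by (simp add: bind_map_pmf)
    also have "\<dots> = trajectory_from Q (f x) (Suc t)"
      by (simp only: lump[OF Suc.prems]) (simp add: map_pmf_def)
    finally show ?case .
  qed
  have "map_pmf (map f) (trajectory K \<mu> t) = trajectory Q (map_pmf f \<mu>) t"
    if "set_pmf \<mu> \<subseteq> S" for \<mu> t
    using that from_state
    by (auto simp: trajectory_def map_bind_pmf bind_map_pmf intro!: bind_pmf_cong)
  moreover have "markov_kernel_on (f ` S) Q"
    using kernel by (auto simp: markov_kernel_on_def simp flip: lump)
  ultimately show ?thesis using kernel by (simp add: lumps_to_def)
qed

lemma stationary_on_map:
  assumes stat: "stationary_on S K \<mu>"
    and lump: "\<And>x. x \<in> S \<Longrightarrow> map_pmf f (K x) = Q (f x)"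
  shows "stationary_on (f ` S) Q (map_pmf f \<mu>)"
proof -
  have "bind_pmf (map_pmf f \<mu>) Q = bind_pmf \<mu> (\<lambda>x. map_pmf f (K x))"
    using stat lump by (auto simp: bind_map_pmf stationary_on_def intro!: bind_pmf_cong)
  also have "\<dots> = map_pmf f (bind_pmf \<mu> K)" by (simp add: map_bind_pmf)
  also have "\<dots> = map_pmf f \<mu>" using stat by (simp add: stationary_on_def)
  finally show ?thesis using stat by (auto simp: stationary_on_def)
qed

text \<open>Detailed balance says that the joint law of two consecutive states is invariant under
  swapping them, so that its two marginals agree.\<close>

lemma stationary_on_if_reversible:
  assumes kernel: "markov_kernel_on S K" and supp: "set_pmf \<mu> \<subseteq> S"
    and balance: "\<And>x y. x \<in> S \<Longrightarrow> y \<in> S \<Longrightarrow> pmf \<mu> x * pmf (K x) y = pmf \<mu> y * pmf (K y) x"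
  shows "stationary_on S K \<mu>"
proof -
  \<comment> \<open>the joint law of a state distributed as \<open>\<mu>\<close> and its successor\<close>
  define J where "J = bind_pmf \<mu> (\<lambda>x. map_pmf (Pair x) (K x))"
  have zero: "pmf \<mu> x = 0" if "x \<notin> S" for x
    using that supp by (auto simp: pmf_eq_0_set_pmf)
  have leave: "pmf (K x) y = 0" if "x \<in> S" "y \<notin> S" for x y
    using that kernel by (auto simp: markov_kernel_on_def pmf_eq_0_set_pmf)
  have J: "pmf J (x, y) = pmf \<mu> x * pmf (K x) y" for x y
  proof -
    have "pmf (map_pmf (Pair z) (K z)) (x, y) = 0" if "z \<noteq> x" for z
      using that by (auto simp: pmf_eq_0_set_pmf)
    hence "pmf J (x, y) = (\<Sum>z\<in>{x}. pmf (map_pmf (Pair z) (K z)) (x, y) * pmf \<mu> z)"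
      unfolding J_def pmf_bind by (intro integral_measure_pmf_real) auto
    thus ?thesis by (simp add: pmf_map_inj' inj_def)
  qed
  have "pmf J (x, y) = pmf J (y, x)" for x y
    using balance[of x y] zero leave by (cases "x \<in> S"; cases "y \<in> S") (auto simp: J)
  moreover have "pmf (map_pmf prod.swap J) (x, y) = pmf J (y, x)" for x y
    using pmf_map_inj'[of prod.swap J "(y, x)"] by simp
  ultimately have swap: "map_pmf prod.swap J = J"
    by (intro pmf_eqI) (auto split: prod.splits simp: split_paired_all)
  have "bind_pmf \<mu> K = map_pmf snd J"
    by (simp add: J_def map_bind_pmf map_pmf_comp)
  also have "\<dots> = map_pmf snd (map_pmf prod.swap J)" by (simp add: swap)
  also have "\<dots> = \<mu>"
    by (simp add: J_def map_bind_pmf map_pmf_comp bind_return_pmf')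
  finally show ?thesis using supp by (simp add: stationary_on_def)
qed

text \<open>Let \<open>c\<close> be the minimum of \<open>\<mu> / \<nu>\<close>, attained at \<open>j\<close>. Then \<open>\<mu> - c \<nu>\<close> is nonnegative, invariant
  under \<open>Q\<close> and zero at \<open>j\<close>. As every state reaches \<open>j\<close> in one step, it vanishes everywhere.\<close>

lemma stationary_on_unique:
  assumes fin: "finite T"
    and full: "\<And>x. x \<in> T \<Longrightarrow> set_pmf (Q x) = T"
    and \<mu>: "stationary_on T Q \<mu>" and \<nu>: "stationary_on T Q \<nu>"
  shows "\<mu> = \<nu>"
proof -
  have flow: "pmf \<rho> k = (\<Sum>i\<in>T. pmf (Q i) k * pmf \<rho> i)" if "stationary_on T Q \<rho>" for \<rho> k
  proof -
    have "pmf \<rho> k = pmf (bind_pmf \<rho> Q) k" using that by (simp add: stationary_on_def)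
    also have "\<dots> = (\<Sum>i\<in>T. pmf (Q i) k * pmf \<rho> i)"
      unfolding pmf_bind using that fin
      by (intro integral_measure_pmf_real) (auto simp: stationary_on_def)
    finally show ?thesis .
  qed
  have Qpos: "pmf (Q i) k > 0" if "i \<in> T" "k \<in> T" for i k
    using full[OF that(1)] that(2) by (intro pmf_positive) simp
  have pos: "pmf \<nu> k > 0" if "k \<in> T" for k
  proof -
    obtain i where i: "i \<in> set_pmf \<nu>" using set_pmf_not_empty by fast
    hence "i \<in> T" using \<nu> by (auto simp: stationary_on_def)
    have "k \<in> set_pmf (bind_pmf \<nu> Q)" using i full[OF \<open>i \<in> T\<close>] that by auto
    hence "k \<in> set_pmf \<nu>" using \<nu> by (simp only: stationary_on_def)
    thus ?thesis by (rule pmf_positive)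
  qed
  have "T \<noteq> {}" using \<nu> set_pmf_not_empty[of \<nu>] by (auto simp: stationary_on_def)
  define c where "c = Min ((\<lambda>k. pmf \<mu> k / pmf \<nu> k) ` T)"
  have "c \<in> (\<lambda>k. pmf \<mu> k / pmf \<nu> k) ` T"
    unfolding c_def using fin \<open>T \<noteq> {}\<close> by (intro Min_in) auto
  then obtain j where j: "j \<in> T" "c = pmf \<mu> j / pmf \<nu> j" by auto
  define d where "d k = pmf \<mu> k - c * pmf \<nu> k" for k
  have d_nonneg: "d k \<ge> 0" if "k \<in> T" for k
  proof -
    have "c \<le> pmf \<mu> k / pmf \<nu> k" unfolding c_def using fin that by (intro Min_le) auto
    thus ?thesis using pos[OF that] by (simp add: d_def field_simps)
  qed
  have "(\<Sum>i\<in>T. pmf (Q i) j * d i) = d j"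
    unfolding d_def flow[OF \<mu>, of j] flow[OF \<nu>, of j]
    by (simp add: algebra_simps sum_subtractf sum_distrib_left)
  also have "d j = 0" using j pos[OF j(1)] by (simp add: d_def)
  finally have "\<forall>i\<in>T. pmf (Q i) j * d i = 0"
    using fin d_nonneg by (subst (asm) sum_nonneg_eq_0_iff) auto
  hence d0: "d i = 0" if "i \<in> T" for i using Qpos[OF that j(1)] that by fastforce
  have "(\<Sum>i\<in>T. pmf \<mu> i) = 1" "(\<Sum>i\<in>T. pmf \<nu> i) = 1"
    using fin \<mu> \<nu> by (auto simp: stationary_on_def intro: sum_pmf_eq_1)
  moreover have "(\<Sum>i\<in>T. pmf \<mu> i) = c * (\<Sum>i\<in>T. pmf \<nu> i)"
    using d0 by (simp add: d_def sum_distrib_left)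
  ultimately have "c = 1" by simp
  show ?thesis
  proof (rule pmf_eqI)
    fix k
    show "pmf \<mu> k = pmf \<nu> k"
    proof (cases "k \<in> T")
      case True
      then show ?thesis using d0[of k] \<open>c = 1\<close> by (simp add: d_def)
    next
      case False
      then have "k \<notin> set_pmf \<mu>" "k \<notin> set_pmf \<nu>" using \<mu> \<nu> by (auto simp: stationary_on_def)
      then show ?thesis by (simp add: pmf_eq_0_set_pmf[symmetric])
    qed
  qed
qed


section \<open>Cycles of products and of conjugates\<close>

text \<open>On \<open>A\<close> the product acts as \<open>p\<close>, on \<open>B\<close> as \<open>q\<close>, and neither leaves its own set; so the orbits
  are those of \<open>p\<close> and of \<open>q\<close>.\<close>

lemma num_cycles_disjoint_comp:
  assumes fin: "finite A" "finite B" and disj: "A \<inter> B = {}"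
    and p: "p permutes A" and q: "q permutes B"
  shows "num_cycles (p \<circ> q) (A \<union> B) = num_cycles p A + num_cycles q B"
proof -
  have orbA: "orbit (p \<circ> q) i = orbit p i" if "i \<in> A" for i
  proof (rule orbit_cong0[symmetric, OF that])
    show "p \<in> A \<rightarrow> A" using p by (auto simp: permutes_in_image)
    show "p y = (p \<circ> q) y" if "y \<in> A" for y
    proof -
      have "y \<notin> B" using that disj by auto
      thus ?thesis using q by (simp add: permutes_not_in)
    qed
  qed
  have orbB: "orbit (p \<circ> q) i = orbit q i" if "i \<in> B" for i
  proof (rule orbit_cong0[symmetric, OF that])
    show "q \<in> B \<rightarrow> B" using q by (auto simp: permutes_in_image)
    show "q y = (p \<circ> q) y" if "y \<in> B" for y
    proof -
      have "q y \<notin> A" using that disj q by (metis disjoint_iff permutes_in_image)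
      thus ?thesis using p by (simp add: permutes_not_in)
    qed
  qed
  have "orbit (p \<circ> q) ` (A \<union> B) = orbit p ` A \<union> orbit q ` B"
    by (simp add: image_Un orbA orbB cong: image_cong)
  moreover have "orbit p ` A \<inter> orbit q ` B = {}"
  proof -
    have "orbit p i \<noteq> orbit q j" if "i \<in> A" "j \<in> B" for i j
      using permutes_orbit_subset[OF p that(1)] permutes_orbit_subset[OF q that(2)]
        orbit.base[of p i] disj by blast
    thus ?thesis by auto
  qed
  ultimately show ?thesis
    using fin by (simp add: num_cycles_def cycles_of_def card_Un_disjoint)
qed

lemma num_cycles_conj:
  assumes "finite A" "\<pi> permutes A" "\<sigma> permutes A"
  shows "num_cycles (inv \<pi> \<circ> \<sigma> \<circ> \<pi>) A = num_cycles \<sigma> A"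
proof -
  have orb: "orbit (inv \<pi> \<circ> \<sigma> \<circ> \<pi>) i = inv \<pi> ` orbit \<sigma> (\<pi> i)" for i
  proof -
    have "inv \<pi> ` orbit \<sigma> (\<pi> i) = orbit (inv \<pi> \<circ> \<sigma> \<circ> \<pi>) (inv \<pi> (\<pi> i))"
      using assms
      by (intro orbit_inverse permutation_self_in_orbit)
        (auto simp: permutation_permutes permutes_inverses)
    thus ?thesis by (simp add: permutes_inverses[OF assms(2)])
  qed
  have "cycles_of (inv \<pi> \<circ> \<sigma> \<circ> \<pi>) A = (`) (inv \<pi>) ` orbit \<sigma> ` \<pi> ` A"
    by (simp add: cycles_of_def orb image_image)
  also have "\<dots> = (`) (inv \<pi>) ` cycles_of \<sigma> A"
    by (simp add: permutes_image[OF assms(2)] cycles_of_def)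
  finally show ?thesis
    using inj_on_image[OF inj_on_subset[OF permutes_inj[OF permutes_inv[OF assms(2)]] subset_UNIV]]
    by (simp add: num_cycles_def card_image)
qed

text \<open>A permutation of \<open>A \<union> B\<close> that preserves \<open>A\<close> also preserves \<open>B\<close>, and its restrictions to the
  two sets are the unique factors.\<close>

lemma bij_betw_disjoint_comp:
  assumes disj: "A \<inter> B = {}"
  shows "bij_betw (\<lambda>(p, q). p \<circ> q) ({p. p permutes A} \<times> {q. q permutes B})
    {\<sigma>. \<sigma> permutes A \<union> B \<and> \<sigma> ` A = A}"
proof -
  let ?r = "\<lambda>\<sigma>. (perm_restrict \<sigma> A, perm_restrict \<sigma> B)"
  have left: "p \<circ> q permutes A \<union> B" "(p \<circ> q) ` A = A" "perm_restrict (p \<circ> q) A = p"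
    "perm_restrict (p \<circ> q) B = q" if p: "p permutes A" and q: "q permutes B" for p q
  proof -
    have onA: "q i = i" if "i \<in> A" for i using that disj q by (auto intro: permutes_not_in)
    have onB: "p (q i) = q i" if "i \<in> B" for i
    proof -
      have "q i \<in> B" using that q by (simp add: permutes_in_image)
      thus ?thesis using disj p by (auto intro: permutes_not_in)
    qed
    show "p \<circ> q permutes A \<union> B"
      using p q by (intro permutes_compose) (auto intro: permutes_subset)
    have "(p \<circ> q) ` A = p ` A" using onA by (auto simp: image_def)
    thus "(p \<circ> q) ` A = A" using p by (simp add: permutes_image)
    show "perm_restrict (p \<circ> q) A = p"
      using onA p by (auto simp: perm_restrict_def fun_eq_iff permutes_not_in)
    show "perm_restrict (p \<circ> q) B = q"
      using onB q by (auto simp: perm_restrict_def fun_eq_iff permutes_not_in)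
  qed
  have right: "perm_restrict \<sigma> A permutes A" "perm_restrict \<sigma> B permutes B"
    "perm_restrict \<sigma> A \<circ> perm_restrict \<sigma> B = \<sigma>"
    if \<sigma>: "\<sigma> permutes A \<union> B" and img: "\<sigma> ` A = A" for \<sigma>
  proof -
    have perm: "perm_restrict \<sigma> C permutes C" if "\<sigma> ` C = C" for C
    proof -
      have "bij_betw \<sigma> C C"
        using that permutes_inj[OF \<sigma>] by (auto simp: bij_betw_def intro: inj_on_subset)
      hence "bij_betw (perm_restrict \<sigma> C) C C"
        by (rule bij_betw_cong[THEN iffD1, rotated]) (simp add: perm_restrict_simps)
      thus ?thesis by (rule bij_imp_permutes) (simp add: perm_restrict_simps)
    qed
    show A: "perm_restrict \<sigma> A permutes A" using img by (rule perm)
    have "B = (A \<union> B) - A" using disj by auto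
    hence "\<sigma> ` B = \<sigma> ` (A \<union> B) - \<sigma> ` A"
      using permutes_inj[OF \<sigma>] by (metis image_set_diff)
    also have "\<dots> = B" using permutes_image[OF \<sigma>] img disj by auto
    finally show B: "perm_restrict \<sigma> B permutes B" by (rule perm)
    show "perm_restrict \<sigma> A \<circ> perm_restrict \<sigma> B = \<sigma>"
      using perm_restrict_union[OF A B disj] perm_restrict_id[OF \<sigma>] by simp
  qed
  show ?thesis
  proof (rule bij_betw_byWitness[where f' = ?r])
    show "(\<lambda>(p, q). p \<circ> q) ` ({p. p permutes A} \<times> {q. q permutes B})
        \<subseteq> {\<sigma>. \<sigma> permutes A \<union> B \<and> \<sigma> ` A = A}"
    proof clarify
      fix p q assume pq: "p permutes A" "q permutes B"
      show "p \<circ> q permutes A \<union> B \<and> (p \<circ> q) ` A = A"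
        using left(1,2)[OF pq] by (rule conjI)
    qed
  qed (auto simp: left right)
qed


section \<open>Transition probabilities of the twisted Burnside process\<close>

definition stabilizer :: "nat \<Rightarrow> (nat \<Rightarrow> bool) \<Rightarrow> (nat \<Rightarrow> nat) set" where
  "stabilizer n x = {\<sigma>. \<sigma> permutes {..<n} \<and> (\<forall>i<n. x (\<sigma> i) = x i)}"

text \<open>For \<open>t = \<theta> / 2\<close> this is the transition probability from \<open>x\<close> to \<open>y\<close> before division by the
  normalising constant of \<open>x\<close>.\<close>

definition common_stabilizer_weight ::
  "nat \<Rightarrow> real \<Rightarrow> (nat \<Rightarrow> bool) \<Rightarrow> (nat \<Rightarrow> bool) \<Rightarrow> real" where
  "common_stabilizer_weight n t x y =
     (\<Sum>\<sigma>\<in>stabilizer n x \<inter> stabilizer n y. t ^ num_cycles \<sigma> {..<n})"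

definition stabilizer_ewens :: "nat \<Rightarrow> real \<Rightarrow> (nat \<Rightarrow> bool) \<Rightarrow> (nat \<Rightarrow> nat) pmf" where
  "stabilizer_ewens n \<theta> x =
     map_pmf (\<lambda>(p, q). p \<circ> q) (pair_pmf (ewens_pmf \<theta> (ones n x)) (ewens_pmf \<theta> (zeros n x)))"

definition coin_labels :: "nat \<Rightarrow> (nat \<Rightarrow> nat) \<Rightarrow> (nat \<Rightarrow> bool) pmf" where
  "coin_labels n \<sigma> = map_pmf (\<lambda>label. \<lambda>i\<in>{..<n}. label (orbit \<sigma> i))
     (Pi_pmf (cycles_of \<sigma> {..<n}) False (\<lambda>_. bernoulli_pmf (1/2)))"

lemma twisted_burnside_eq_bind:
  "twisted_burnside n \<theta> x = bind_pmf (stabilizer_ewens n \<theta> x) (coin_labels n)"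
  unfolding twisted_burnside_def stabilizer_ewens_def coin_labels_def pair_pmf_def map_pmf_def Let_def
    bind_assoc_pmf bind_return_pmf prod.case ..

lemma finite_stabilizer: "finite (stabilizer n x)"
  unfolding stabilizer_def
  by (rule finite_subset[OF _ finite_permutations[of "{..<n}"]]) auto

lemma finite_ones_zeros [simp]: "finite (ones n x)" "finite (zeros n x)"
  by (auto simp: ones_def zeros_def)

lemma ones_zeros_partition:
  "ones n x \<inter> zeros n x = {}" "ones n x \<union> zeros n x = {..<n}"
  by (auto simp: ones_def zeros_def)

lemma card_zeros: "card (zeros n x) = n - num_ones n x"
proof -
  have "card (ones n x \<union> zeros n x) = card (ones n x) + card (zeros n x)"
    by (rule card_Un_disjoint) (auto simp: ones_zeros_partition)
  thus ?thesis by (simp add: ones_zeros_partition num_ones_def)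
qed

lemma num_ones_le: "num_ones n x \<le> n"
proof -
  have "card (ones n x) \<le> card {..<n}" by (rule card_mono) (auto simp: ones_def)
  thus ?thesis by (simp add: num_ones_def)
qed

text \<open>Fixing \<open>x\<close> means mapping the ones of \<open>x\<close> to ones.\<close>

lemma bij_betw_stabilizer:
  "bij_betw (\<lambda>(p, q). p \<circ> q) ({p. p permutes ones n x} \<times> {q. q permutes zeros n x})
     (stabilizer n x)"
proof -
  have "\<sigma> ` ones n x = ones n x \<longleftrightarrow> (\<forall>i<n. x (\<sigma> i) = x i)" if \<sigma>: "\<sigma> permutes {..<n}" for \<sigma>
  proof
    assume eq: "\<sigma> ` ones n x = ones n x"
    show "\<forall>i<n. x (\<sigma> i) = x i"
    proof (intro allI impI)
      fix i assume "i < n"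
      have "\<sigma> i \<in> ones n x \<longleftrightarrow> i \<in> ones n x"
        using eq permutes_inj[OF \<sigma>] by (metis inj_image_mem_iff)
      thus "x (\<sigma> i) = x i"
        using \<open>i < n\<close> permutes_in_image[OF \<sigma>, of i] by (auto simp: ones_def)
    qed
  next
    assume inv: "\<forall>i<n. x (\<sigma> i) = x i"
    have "\<sigma> ` ones n x \<subseteq> ones n x"
      using inv permutes_in_image[OF \<sigma>] by (auto simp: ones_def)
    thus "\<sigma> ` ones n x = ones n x"
      using permutes_inj[OF \<sigma>] by (intro endo_inj_surj) (auto intro: inj_on_subset)
  qed
  hence "stabilizer n x = {\<sigma>. \<sigma> permutes ones n x \<union> zeros n x \<and> \<sigma> ` ones n x = ones n x}"
    unfolding ones_zeros_partition stabilizer_def by blast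
  thus ?thesis using bij_betw_disjoint_comp[OF ones_zeros_partition(1)[of n x]] by simp
qed

lemma set_pmf_ewens:
  assumes "\<theta> > 0" "finite A"
  shows "set_pmf (ewens_pmf \<theta> A) = {\<sigma>. \<sigma> permutes A}"
proof -
  have "pochhammer \<theta> (card A) > 0" using assms(1) by (rule pochhammer_pos)
  thus ?thesis using assms(1) by (auto simp: set_pmf_eq pmf_ewens[OF assms])
qed

lemma stabilizer_ewens:
  assumes "\<theta> > 0"
  shows set_pmf_stabilizer_ewens: "set_pmf (stabilizer_ewens n \<theta> x) = stabilizer n x"
    and pmf_stabilizer_ewens: "\<sigma> \<in> stabilizer n x \<Longrightarrow> pmf (stabilizer_ewens n \<theta> x) \<sigma> =
      \<theta> ^ num_cycles \<sigma> {..<n} / (pochhammer \<theta> (num_ones n x) * pochhammer \<theta> (n - num_ones n x))"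
proof -
  let ?E = "pair_pmf (ewens_pmf \<theta> (ones n x)) (ewens_pmf \<theta> (zeros n x))"
  have E: "set_pmf ?E = {p. p permutes ones n x} \<times> {q. q permutes zeros n x}"
    using assms by (simp add: set_pmf_ewens)
  show "set_pmf (stabilizer_ewens n \<theta> x) = stabilizer n x"
    using bij_betw_imp_surj_on[OF bij_betw_stabilizer[of n x]]
    unfolding stabilizer_ewens_def set_map_pmf E by simp
  assume "\<sigma> \<in> stabilizer n x"
  then obtain p q where pq: "p permutes ones n x" "q permutes zeros n x" "\<sigma> = p \<circ> q"
    using bij_betw_imp_surj_on[OF bij_betw_stabilizer[of n x]] by force
  have "inj_on (\<lambda>(p, q). p \<circ> q) (set_pmf ?E)"
    unfolding E by (rule bij_betw_imp_inj_on[OF bij_betw_stabilizer])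
  moreover have "(p, q) \<in> set_pmf ?E" using pq unfolding E by simp
  ultimately have "pmf (stabilizer_ewens n \<theta> x) \<sigma> = pmf ?E (p, q)"
    using pmf_map_inj[of "\<lambda>(p, q). p \<circ> q" ?E "(p, q)"] pq(3)
    by (simp add: stabilizer_ewens_def)
  also have "\<dots> = \<theta> ^ (num_cycles p (ones n x) + num_cycles q (zeros n x)) /
      (pochhammer \<theta> (num_ones n x) * pochhammer \<theta> (n - num_ones n x))"
    using assms pq by (simp add: pmf_pair pmf_ewens power_add card_zeros num_ones_def)
  also have "num_cycles p (ones n x) + num_cycles q (zeros n x) = num_cycles \<sigma> {..<n}"
    using num_cycles_disjoint_comp[OF _ _ ones_zeros_partition(1) pq(1,2)] pq(3)
    by (simp add: ones_zeros_partition)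
  finally show "pmf (stabilizer_ewens n \<theta> x) \<sigma> = \<theta> ^ num_cycles \<sigma> {..<n} /
      (pochhammer \<theta> (num_ones n x) * pochhammer \<theta> (n - num_ones n x))" .
qed

text \<open>A labelling of the cycles and the state it paints determine each other, and the states obtained
  are those constant on the cycles of \<open>\<sigma>\<close>. Hence the probability of such a state is that of a single
  outcome of \<open>num_cycles \<sigma> {..<n}\<close> fair coins.\<close>

lemma coin_labels:
  assumes \<sigma>: "\<sigma> permutes {..<n}"
  shows set_pmf_coin_labels: "set_pmf (coin_labels n \<sigma>) = {y \<in> cube n. \<sigma> \<in> stabilizer n y}"
    and pmf_coin_labels: "y \<in> cube n \<Longrightarrow> pmf (coin_labels n \<sigma>) y =
      (if \<sigma> \<in> stabilizer n y then (1/2) ^ num_cycles \<sigma> {..<n} else 0)"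
proof -
  let ?C = "cycles_of \<sigma> {..<n}"
  let ?L = "Pi_pmf ?C False (\<lambda>_. bernoulli_pmf (1/2))"
  define paint where "paint label = (\<lambda>i\<in>{..<n}. label (orbit \<sigma> i))" for label :: "nat set \<Rightarrow> bool"
  have coin: "coin_labels n \<sigma> = map_pmf paint ?L"
    by (simp add: coin_labels_def paint_def[abs_def])
  have finC: "finite ?C" by (simp add: cycles_of_def)
  have perm: "permutation \<sigma>" using \<sigma> by (auto simp: permutation_permutes)
  have supp: "set_pmf ?L = {label. \<forall>C. C \<notin> ?C \<longrightarrow> \<not> label C}"
    using finC by (auto simp: set_Pi_pmf PiE_dflt_def set_pmf_bernoulli)
  have paint_fixed: "paint label \<in> cube n" "\<sigma> \<in> stabilizer n (paint label)" for label
    using \<sigma> permutation_orbit_step[OF perm] permutes_in_image[OF \<sigma>]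
    by (auto simp: paint_def cube_def stabilizer_def)
  have inj: "inj_on paint (set_pmf ?L)"
  proof (rule inj_onI, rule ext)
    fix l l' C assume l: "l \<in> set_pmf ?L" "l' \<in> set_pmf ?L" and eq: "paint l = paint l'"
    show "l C = l' C"
    proof (cases "C \<in> ?C")
      case True
      then obtain i where "i < n" "C = orbit \<sigma> i" by (auto simp: cycles_of_def)
      then show ?thesis using fun_cong[OF eq, of i] by (simp add: paint_def)
    next
      case False
      then show ?thesis using l unfolding supp by auto
    qed
  qed
  have preimage: "\<exists>l \<in> set_pmf ?L. paint l = y" if y: "y \<in> cube n" "\<sigma> \<in> stabilizer n y" for y
  proof
    \<comment> \<open>as \<open>y\<close> is constant on \<open>C\<close>, the existential quantifier picks out this constant value; outside
      the set of cycles the label has to be the default \<open>False\<close>\<close>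
    let ?l = "\<lambda>C. C \<in> ?C \<and> (\<exists>i\<in>C. y i)"
    show "?l \<in> set_pmf ?L" unfolding supp by auto
    have const: "y j = y i" if "i < n" "j \<in> orbit \<sigma> i" for i j
    proof -
      have "j < n \<and> y j = y i" using that(2)
      proof induction
        case base
        show ?case using that(1) y(2) permutes_in_image[OF \<sigma>, of i] by (auto simp: stabilizer_def)
      next
        case (step j)
        then show ?case using y(2) permutes_in_image[OF \<sigma>, of j] by (auto simp: stabilizer_def)
      qed
      thus ?thesis by simp
    qed
    show "paint ?l = y"
    proof
      fix i
      show "paint ?l i = y i"
      proof (cases "i < n")
        case True
        have "(\<exists>j\<in>orbit \<sigma> i. y j) = y i"
          using const[OF True] permutation_self_in_orbit[OF perm, of i] by blast
        then show ?thesis using True by (simp add: paint_def cycles_of_def)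
      next
        case False
        then have "y i = undefined" using y(1) unfolding cube_def by (intro PiE_arb[of y]) auto
        then show ?thesis using False by (simp add: paint_def)
      qed
    qed
  qed
  show set: "set_pmf (coin_labels n \<sigma>) = {y \<in> cube n. \<sigma> \<in> stabilizer n y}"
    using paint_fixed preimage unfolding coin set_map_pmf by blast
  assume y: "y \<in> cube n"
  show "pmf (coin_labels n \<sigma>) y =
      (if \<sigma> \<in> stabilizer n y then (1/2) ^ num_cycles \<sigma> {..<n} else 0)"
  proof (cases "\<sigma> \<in> stabilizer n y")
    case True
    then obtain l where l: "l \<in> set_pmf ?L" "paint l = y" using preimage y by blast
    have "pmf (coin_labels n \<sigma>) y = pmf ?L l"
      unfolding coin l(2)[symmetric] by (rule pmf_map_inj[OF inj l(1)])
    also have "\<dots> = (\<Prod>C\<in>?C. pmf (bernoulli_pmf (1/2)) (l C))"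
      using l(1) finC unfolding supp by (intro pmf_Pi') auto
    also have "\<dots> = (\<Prod>C\<in>?C. 1/2)"
    proof (rule prod.cong[OF refl])
      show "pmf (bernoulli_pmf (1/2)) (l C) = 1/2" for C by (cases "l C") auto
    qed
    finally show ?thesis using True by (simp add: num_cycles_def)
  next
    case False
    then show ?thesis using set by (simp add: pmf_eq_0_set_pmf)
  qed
qed

lemma id_in_stabilizer: "id \<in> stabilizer n x"
  by (simp add: stabilizer_def permutes_id)

text \<open>The identity is drawn with positive probability. All its cycles are singletons, and labelling
  these can lead to any state.\<close>

lemma set_pmf_twisted_burnside:
  assumes "\<theta> > 0"
  shows "set_pmf (twisted_burnside n \<theta> x) = cube n"
proof
  have perm: "\<sigma> permutes {..<n}" if "\<sigma> \<in> stabilizer n x" for \<sigma>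
    using that by (simp add: stabilizer_def)
  show "set_pmf (twisted_burnside n \<theta> x) \<subseteq> cube n"
    using perm by (auto simp: twisted_burnside_eq_bind set_pmf_stabilizer_ewens[OF assms]
        set_pmf_coin_labels)
  show "cube n \<subseteq> set_pmf (twisted_burnside n \<theta> x)"
    using id_in_stabilizer by (auto simp: twisted_burnside_eq_bind
        set_pmf_stabilizer_ewens[OF assms] set_pmf_coin_labels permutes_id intro!: bexI[of _ id])
qed

text \<open>A permutation \<open>\<sigma>\<close> in both stabilizers contributes \<open>\<theta>\<^bsup>c(\<sigma>)\<^esup>\<close> from its Ewens weight and
  \<open>(1/2)\<^bsup>c(\<sigma>)\<^esup>\<close> from the coins; the other permutations do not lead from \<open>x\<close> to \<open>y\<close>.\<close>

lemma pmf_twisted_burnside: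
  assumes "\<theta> > 0" and y: "y \<in> cube n"
  shows "pmf (twisted_burnside n \<theta> x) y = common_stabilizer_weight n (\<theta> / 2) x y /
    (pochhammer \<theta> (num_ones n x) * pochhammer \<theta> (n - num_ones n x))"
proof -
  let ?w = "pochhammer \<theta> (num_ones n x) * pochhammer \<theta> (n - num_ones n x)"
  have "pmf (twisted_burnside n \<theta> x) y =
      (\<Sum>\<sigma>\<in>stabilizer n x. pmf (coin_labels n \<sigma>) y * pmf (stabilizer_ewens n \<theta> x) \<sigma>)"
    unfolding twisted_burnside_eq_bind pmf_bind
    by (intro integral_measure_pmf_real finite_stabilizer)
      (simp add: set_pmf_stabilizer_ewens[OF assms(1)])
  also have "\<dots> = (\<Sum>\<sigma>\<in>stabilizer n x. if \<sigma> \<in> stabilizer n y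
      then (\<theta> / 2) ^ num_cycles \<sigma> {..<n} / ?w else 0)"
  proof (rule sum.cong[OF refl])
    fix \<sigma> assume \<sigma>: "\<sigma> \<in> stabilizer n x"
    hence "\<sigma> permutes {..<n}" by (simp add: stabilizer_def)
    thus "pmf (coin_labels n \<sigma>) y * pmf (stabilizer_ewens n \<theta> x) \<sigma> =
        (if \<sigma> \<in> stabilizer n y then (\<theta> / 2) ^ num_cycles \<sigma> {..<n} / ?w else 0)"
      using pmf_stabilizer_ewens[OF assms(1) \<sigma>] pmf_coin_labels[OF _ y]
      by (simp add: power_divide)
  qed
  also have "\<dots> = (\<Sum>\<sigma>\<in>stabilizer n x \<inter> stabilizer n y. (\<theta> / 2) ^ num_cycles \<sigma> {..<n} / ?w)"
    by (rule sum.inter_restrict[OF finite_stabilizer, symmetric])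
  also have "\<dots> = common_stabilizer_weight n (\<theta> / 2) x y / ?w"
    by (simp add: common_stabilizer_weight_def sum_divide_distrib)
  finally show ?thesis .
qed

lemma common_stabilizer_weight_commute:
  "common_stabilizer_weight n t x y = common_stabilizer_weight n t y x"
  by (simp add: common_stabilizer_weight_def Int_commute)


section \<open>Equivariance under permutations of the coordinates\<close>

lemma conj_in_stabilizer:
  assumes \<pi>: "\<pi> permutes {..<n}" and \<sigma>: "\<sigma> \<in> stabilizer n x"
  shows "inv \<pi> \<circ> \<sigma> \<circ> \<pi> \<in> stabilizer n (x \<circ> \<pi>)"
  using \<sigma> permutes_compose[OF permutes_compose[OF \<pi>, of \<sigma>] permutes_inv[OF \<pi>]]
    permutes_in_image[OF \<pi>]
  by (auto simp: stabilizer_def permutes_inverses[OF \<pi>] comp_assoc)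

lemma common_stabilizer_weight_comp:
  assumes \<pi>: "\<pi> permutes {..<n}"
  shows "common_stabilizer_weight n t (x \<circ> \<pi>) (y \<circ> \<pi>) = common_stabilizer_weight n t x y"
  unfolding common_stabilizer_weight_def
proof (rule sum.reindex_bij_witness
    [where i = "\<lambda>\<sigma>. inv \<pi> \<circ> \<sigma> \<circ> \<pi>" and j = "\<lambda>\<tau>. \<pi> \<circ> \<tau> \<circ> inv \<pi>"])
  have cancel: "\<pi> \<circ> inv \<pi> = id" "inv \<pi> \<circ> \<pi> = id" using permutes_inv_o[OF \<pi>] by auto
  fix \<tau> assume \<tau>: "\<tau> \<in> stabilizer n (x \<circ> \<pi>) \<inter> stabilizer n (y \<circ> \<pi>)"
  show "inv \<pi> \<circ> (\<pi> \<circ> \<tau> \<circ> inv \<pi>) \<circ> \<pi> = \<tau>"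
    by (simp add: fun_eq_iff permutes_inverses[OF \<pi>])
  have conj_back: "\<pi> \<circ> \<tau> \<circ> inv \<pi> \<in> stabilizer n z" if "\<tau> \<in> stabilizer n (z \<circ> \<pi>)" for z
    using conj_in_stabilizer[OF permutes_inv[OF \<pi>] that]
    by (simp add: permutes_inv_inv[OF \<pi>] comp_assoc cancel)
  show "\<pi> \<circ> \<tau> \<circ> inv \<pi> \<in> stabilizer n x \<inter> stabilizer n y" using \<tau> conj_back by simp
  show "t ^ num_cycles (\<pi> \<circ> \<tau> \<circ> inv \<pi>) {..<n} = t ^ num_cycles \<tau> {..<n}"
    using num_cycles_conj[OF _ permutes_inv[OF \<pi>], of \<tau>] \<tau>
    by (simp add: permutes_inv_inv[OF \<pi>] stabilizer_def)
next
  fix \<sigma> assume \<sigma>: "\<sigma> \<in> stabilizer n x \<inter> stabilizer n y"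
  show "\<pi> \<circ> (inv \<pi> \<circ> \<sigma> \<circ> \<pi>) \<circ> inv \<pi> = \<sigma>"
    by (simp add: fun_eq_iff permutes_inverses[OF \<pi>])
  show "inv \<pi> \<circ> \<sigma> \<circ> \<pi> \<in> stabilizer n (x \<circ> \<pi>) \<inter> stabilizer n (y \<circ> \<pi>)"
    using \<sigma> conj_in_stabilizer[OF \<pi>] by simp
qed

lemma comp_in_cube:
  assumes "\<pi> permutes {..<n}" "y \<in> cube n"
  shows "y \<circ> \<pi> \<in> cube n"
  using assms by (auto simp: cube_def PiE_iff extensional_def permutes_not_in)

lemma num_ones_comp:
  assumes "\<pi> permutes {..<n}"
  shows "num_ones n (y \<circ> \<pi>) = num_ones n y"
proof -
  have "ones n y = \<pi> ` ones n (y \<circ> \<pi>)"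
  proof
    show "\<pi> ` ones n (y \<circ> \<pi>) \<subseteq> ones n y"
      using permutes_in_image[OF assms] by (auto simp: ones_def)
    show "ones n y \<subseteq> \<pi> ` ones n (y \<circ> \<pi>)"
    proof
      fix i assume "i \<in> ones n y"
      hence "inv \<pi> i \<in> ones n (y \<circ> \<pi>)"
        using permutes_in_image[OF permutes_inv[OF assms], of i]
        by (auto simp: ones_def permutes_inverses[OF assms])
      thus "i \<in> \<pi> ` ones n (y \<circ> \<pi>)"
        using permutes_inverses[OF assms] by (metis imageI)
    qed
  qed
  thus ?thesis
    using permutes_inj[OF assms] by (simp add: num_ones_def card_image inj_on_subset)
qed

text \<open>The orbits of the coordinate permutations on the cube are the level sets of \<^const>\<open>num_ones\<close>:
  match ones with ones and zeros with zeros.\<close>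

lemma ex_permutes_comp_eq:
  assumes x: "x \<in> cube n" and x': "x' \<in> cube n" and eq: "num_ones n x' = num_ones n x"
  shows "\<exists>\<pi>. \<pi> permutes {..<n} \<and> x' = x \<circ> \<pi>"
proof -
  obtain f where f: "bij_betw f (ones n x') (ones n x)"
    using eq finite_same_card_bij[of "ones n x'" "ones n x"] by (auto simp: num_ones_def)
  obtain g where g: "bij_betw g (zeros n x') (zeros n x)"
    using eq finite_same_card_bij[of "zeros n x'" "zeros n x"] by (auto simp: card_zeros)
  define \<pi> where "\<pi> i = (if i \<in> ones n x' then f i else if i \<in> zeros n x' then g i else i)" for i
  have "bij_betw (\<lambda>i. if i \<in> ones n x' then f i else g i)
      (ones n x' \<union> zeros n x') (ones n x \<union> zeros n x)"
    using f g by (intro bij_betw_disjoint_Un) (auto simp: ones_zeros_partition)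
  hence "bij_betw (\<lambda>i. if i \<in> ones n x' then f i else g i) {..<n} {..<n}"
    by (simp add: ones_zeros_partition)
  hence "bij_betw \<pi> {..<n} {..<n}"
    by (rule bij_betw_cong[THEN iffD1, rotated]) (auto simp: \<pi>_def ones_def zeros_def)
  hence perm: "\<pi> permutes {..<n}"
    by (rule bij_imp_permutes) (auto simp: \<pi>_def ones_def zeros_def)
  have "x' i = x (\<pi> i)" for i
  proof -
    consider "i \<in> ones n x'" | "i \<in> zeros n x'" | "\<not> i < n" by (auto simp: ones_def zeros_def)
    thus ?thesis
    proof cases
      case 1
      hence "\<pi> i \<in> ones n x" using f by (auto simp: \<pi>_def bij_betw_def)
      thus ?thesis using 1 by (simp add: ones_def)
    next
      case 2
      hence "i \<notin> ones n x'" by (auto simp: ones_def zeros_def)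
      hence "\<pi> i \<in> zeros n x" using g 2 by (auto simp: \<pi>_def bij_betw_def)
      thus ?thesis using 2 by (simp add: zeros_def)
    next
      case 3
      hence "\<pi> i = i" using perm by (simp add: permutes_not_in)
      moreover have "x i = undefined" using 3 x unfolding cube_def by (intro PiE_arb[of x]) auto
      moreover have "x' i = undefined" using 3 x' unfolding cube_def by (intro PiE_arb[of x']) auto
      ultimately show ?thesis by simp
    qed
  qed
  thus ?thesis using perm by (auto simp: fun_eq_iff)
qed

lemma twisted_burnside_comp:
  assumes "\<theta> > 0" and \<pi>: "\<pi> permutes {..<n}"
  shows "twisted_burnside n \<theta> (x \<circ> \<pi>) = map_pmf (\<lambda>y. y \<circ> \<pi>) (twisted_burnside n \<theta> x)"
proof (rule pmf_eqI)
  fix y :: "nat \<Rightarrow> bool"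
  let ?y = "y \<circ> inv \<pi>"
  have y: "y = ?y \<circ> \<pi>" by (simp add: fun_eq_iff permutes_inverses[OF \<pi>])
  have "inj (\<lambda>y. y \<circ> \<pi>)"
    by (rule inj_on_inverseI[where g = "\<lambda>y. y \<circ> inv \<pi>"])
      (simp add: fun_eq_iff permutes_inverses[OF \<pi>])
  hence "pmf (map_pmf (\<lambda>y. y \<circ> \<pi>) (twisted_burnside n \<theta> x)) y = pmf (twisted_burnside n \<theta> x) ?y"
    using pmf_map_inj'[of "\<lambda>y. y \<circ> \<pi>" _ ?y] y by metis
  also have "\<dots> = pmf (twisted_burnside n \<theta> (x \<circ> \<pi>)) y"
  proof (cases "y \<in> cube n")
    case True
    hence "?y \<in> cube n" using comp_in_cube[OF permutes_inv[OF \<pi>]] by simp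
    moreover have "common_stabilizer_weight n (\<theta> / 2) (x \<circ> \<pi>) y =
        common_stabilizer_weight n (\<theta> / 2) x ?y"
      using common_stabilizer_weight_comp[OF \<pi>, of "\<theta> / 2" x ?y] y by simp
    ultimately show ?thesis
      using True assms by (simp add: pmf_twisted_burnside num_ones_comp)
  next
    case False
    hence "?y \<notin> cube n" using comp_in_cube[OF \<pi>, of ?y] y by auto
    moreover have "pmf (twisted_burnside n \<theta> z) w = 0" if "w \<notin> cube n" for z w
      using that by (simp add: pmf_eq_0_set_pmf set_pmf_twisted_burnside[OF assms(1)])
    ultimately show ?thesis using False by simp
  qed
  finally show "pmf (twisted_burnside n \<theta> (x \<circ> \<pi>)) y =
      pmf (map_pmf (\<lambda>y. y \<circ> \<pi>) (twisted_burnside n \<theta> x)) y" by simp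
qed

lemma map_num_ones_twisted_burnside:
  assumes "\<theta> > 0" "x \<in> cube n" "x' \<in> cube n" "num_ones n x' = num_ones n x"
  shows "map_pmf (num_ones n) (twisted_burnside n \<theta> x') =
    map_pmf (num_ones n) (twisted_burnside n \<theta> x)"
proof -
  obtain \<pi> where \<pi>: "\<pi> permutes {..<n}" "x' = x \<circ> \<pi>"
    using ex_permutes_comp_eq[OF assms(2-4)] by auto
  show ?thesis
    by (simp add: \<pi> twisted_burnside_comp[OF assms(1) \<pi>(1)] map_pmf_comp num_ones_comp)
qed


section \<open>The stationary law on the cube\<close>

lemma finite_cube: "finite (cube n)"
  by (simp add: cube_def finite_PiE)

lemma bij_betw_ones: "bij_betw (ones n) (cube n) (Pow {..<n})"
  by (rule bij_betw_byWitness[where f' = "\<lambda>A. \<lambda>i\<in>{..<n}. i \<in> A"])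
    (auto simp: cube_def ones_def PiE_iff extensional_def fun_eq_iff)

lemma card_layer: "card {x \<in> cube n. num_ones n x = j} = n choose j"
proof -
  have "bij_betw (ones n) {x \<in> cube n. num_ones n x = j} {A \<in> Pow {..<n}. card A = j}"
    using bij_betw_ones[of n] unfolding num_ones_def by (rule bij_betw_Collect) simp
  hence "card {x \<in> cube n. num_ones n x = j} = card {A \<in> Pow {..<n}. card A = j}"
    by (rule bij_betw_same_card)
  thus ?thesis using n_subsets[of "{..<n}" j] by (simp add: Pow_def)
qed

text \<open>The law on the cube that is proportional to the normalising constants
  \<open>(\<theta>)\<^sub>j (\<theta>)\<^bsub>n-j\<^esub>\<close>. Drawing first the number of ones and then a uniform state in that layer makes
  the law of the number of ones beta-binomial by construction; the binomial coefficient cancels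
  against the size of the layer.\<close>

definition layered_beta_binomial :: "nat \<Rightarrow> real \<Rightarrow> (nat \<Rightarrow> bool) pmf" where
  "layered_beta_binomial n \<theta> =
     bind_pmf (beta_binomial_pmf n \<theta> \<theta>) (\<lambda>j. pmf_of_set {x \<in> cube n. num_ones n x = j})"

lemma layer_nonempty:
  assumes "j \<le> n"
  shows "{x \<in> cube n. num_ones n x = j} \<noteq> {}"
  using card_layer[of n j] assms by (metis binomial_eq_0_iff card.empty not_le)

lemma set_pmf_beta_binomial:
  assumes "\<theta> > 0"
  shows "set_pmf (beta_binomial_pmf n \<theta> \<theta>) \<subseteq> {0..n}"
  by (auto simp: set_pmf_eq pmf_beta_binomial[OF assms assms] split: if_splits)

lemma layered_beta_binomial:
  assumes "\<theta> > 0"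
  shows set_pmf_layered: "set_pmf (layered_beta_binomial n \<theta>) \<subseteq> cube n"
    and pmf_layered: "x \<in> cube n \<Longrightarrow> pmf (layered_beta_binomial n \<theta>) x =
      pochhammer \<theta> (num_ones n x) * pochhammer \<theta> (n - num_ones n x) / pochhammer (\<theta> + \<theta>) n"
    and map_num_ones_layered:
      "map_pmf (num_ones n) (layered_beta_binomial n \<theta>) = beta_binomial_pmf n \<theta> \<theta>"
proof -
  let ?m = "beta_binomial_pmf n \<theta> \<theta>" and ?U = "\<lambda>j. pmf_of_set {x \<in> cube n. num_ones n x = j}"
  have fin: "finite {x \<in> cube n. num_ones n x = j}" for j using finite_cube by simp
  have m: "j \<le> n" if "j \<in> set_pmf ?m" for j
    using that set_pmf_beta_binomial[OF assms, of n] by auto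
  have U: "set_pmf (?U j) = {x \<in> cube n. num_ones n x = j}" if "j \<in> set_pmf ?m" for j
    using layer_nonempty[OF m[OF that]] fin by (rule set_pmf_of_set)
  show "set_pmf (layered_beta_binomial n \<theta>) \<subseteq> cube n"
    using U by (auto simp: layered_beta_binomial_def)
  have "map_pmf (num_ones n) (?U j) = return_pmf j" if "j \<in> set_pmf ?m" for j
  proof -
    have "map_pmf (num_ones n) (?U j) = map_pmf (\<lambda>_. j) (?U j)"
      using U[OF that] by (intro map_pmf_cong) auto
    thus ?thesis by simp
  qed
  hence "map_pmf (num_ones n) (layered_beta_binomial n \<theta>) = bind_pmf ?m return_pmf"
    unfolding layered_beta_binomial_def map_bind_pmf by (intro bind_pmf_cong refl)
  thus "map_pmf (num_ones n) (layered_beta_binomial n \<theta>) = ?m"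
    by (simp add: bind_return_pmf')
  assume x: "x \<in> cube n"
  let ?k = "num_ones n x"
  have "pmf (layered_beta_binomial n \<theta>) x = (\<Sum>j\<in>{?k}. pmf (?U j) x * pmf ?m j)"
    unfolding layered_beta_binomial_def pmf_bind
    using U by (intro integral_measure_pmf_real) (auto simp: pmf_eq_0_set_pmf)
  also have "\<dots> = pmf ?m ?k / real (n choose ?k)"
    using x layer_nonempty[OF num_ones_le[of n x]] fin by (simp add: card_layer)
  also have "\<dots> = pochhammer \<theta> ?k * pochhammer \<theta> (n - ?k) / pochhammer (\<theta> + \<theta>) n"
    using num_ones_le[of n x] by (simp add: pmf_beta_binomial[OF assms assms] binomial_eq_0_iff)
  finally show "pmf (layered_beta_binomial n \<theta>) x =
      pochhammer \<theta> ?k * pochhammer \<theta> (n - ?k) / pochhammer (\<theta> + \<theta>) n" .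
qed

text \<open>The normalising constant of \<open>x\<close> cancels in the probability flow from \<open>x\<close> to \<open>y\<close>, which leaves
  the symmetric \<^const>\<open>common_stabilizer_weight\<close>.\<close>

lemma stationary_on_layered:
  assumes "\<theta> > 0"
  shows "stationary_on (cube n) (twisted_burnside n \<theta>) (layered_beta_binomial n \<theta>)"
proof (rule stationary_on_if_reversible)
  show "markov_kernel_on (cube n) (twisted_burnside n \<theta>)"
    by (simp add: markov_kernel_on_def set_pmf_twisted_burnside[OF assms])
  show "set_pmf (layered_beta_binomial n \<theta>) \<subseteq> cube n" by (rule set_pmf_layered[OF assms])
  have pos: "pochhammer \<theta> k > 0" for k using assms by (rule pochhammer_pos)
  have edge_flow: "pmf (layered_beta_binomial n \<theta>) x * pmf (twisted_burnside n \<theta> x) y =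
      common_stabilizer_weight n (\<theta> / 2) x y / pochhammer (\<theta> + \<theta>) n"
    if "x \<in> cube n" "y \<in> cube n" for x y
    using pos[THEN less_imp_neq] that
    by (simp add: pmf_layered[OF assms] pmf_twisted_burnside[OF assms])
  show "pmf (layered_beta_binomial n \<theta>) x * pmf (twisted_burnside n \<theta> x) y =
      pmf (layered_beta_binomial n \<theta>) y * pmf (twisted_burnside n \<theta> y) x"
    if "x \<in> cube n" "y \<in> cube n" for x y
    using that by (simp add: edge_flow common_stabilizer_weight_commute)
qed


section \<open>The lumped chain\<close>

theorem proposition5p1:
  fixes n :: nat and \<theta> :: real
  assumes "n \<ge> 1" and "\<theta> > 0"
  shows "\<exists>Q. lumps_to (cube n) (twisted_burnside n \<theta>) (num_ones n) {0..n} Q \<and>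
             (\<forall>\<mu>. stationary_on {0..n} Q \<mu> \<longleftrightarrow> \<mu> = beta_binomial_pmf n \<theta> \<theta>) \<and>
             (\<forall>j\<in>{0..n}. pmf (beta_binomial_pmf n \<theta> \<theta>) j =
                real (n choose j) * (pochhammer \<theta> j * pochhammer \<theta> (n - j)) / pochhammer (2 * \<theta>) n)"
proof -
  let ?K = "twisted_burnside n \<theta>"
  \<comment> \<open>the lumped kernel runs one step from an arbitrary state with \<open>j\<close> ones\<close>
  define rep where "rep j = (SOME x. x \<in> cube n \<and> num_ones n x = j)" for j
  define Q where "Q j = map_pmf (num_ones n) (?K (rep j))" for j
  have rep: "rep j \<in> cube n" "num_ones n (rep j) = j" if "j \<le> n" for j
    using someI_ex[of "\<lambda>x. x \<in> cube n \<and> num_ones n x = j"] layer_nonempty[OF that]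
    by (auto simp: rep_def)
  have lump: "map_pmf (num_ones n) (?K x) = Q (num_ones n x)" if "x \<in> cube n" for x
    unfolding Q_def using assms(2) rep[OF num_ones_le] that
    by (intro map_num_ones_twisted_burnside) auto
  have image: "num_ones n ` cube n = {0..n}"
    using num_ones_le rep by (force intro: image_eqI[of _ _ "rep _"])
  have kernel: "markov_kernel_on (cube n) ?K"
    by (simp add: markov_kernel_on_def set_pmf_twisted_burnside[OF assms(2)])
  have "lumps_to (cube n) ?K (num_ones n) {0..n} Q"
    using lumps_toI[OF kernel lump] by (simp add: image)
  moreover have stat: "stationary_on {0..n} Q (beta_binomial_pmf n \<theta> \<theta>)"
    using stationary_on_map[OF stationary_on_layered[OF assms(2)] lump]
    by (simp add: image map_num_ones_layered[OF assms(2)])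
  moreover have "\<mu> = beta_binomial_pmf n \<theta> \<theta>" if "stationary_on {0..n} Q \<mu>" for \<mu>
  proof (rule stationary_on_unique[OF _ _ that stat])
    show "set_pmf (Q j) = {0..n}" for j
      by (simp add: Q_def set_pmf_twisted_burnside[OF assms(2)] image)
  qed simp
  moreover have "pmf (beta_binomial_pmf n \<theta> \<theta>) j =
      real (n choose j) * (pochhammer \<theta> j * pochhammer \<theta> (n - j)) / pochhammer (2 * \<theta>) n"
    if "j \<in> {0..n}" for j
    using that by (simp add: pmf_beta_binomial[OF assms(2) assms(2)] flip: mult_2)
  ultimately show ?thesis by blast
qed

end
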